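(* Suppose $n, m \in \mathbb{N}$ satisfy $2 \leq n \leq m$. Then $$\max \left \{ n+1, \left \lceil \frac{n}{2} \right \rceil + \left \lceil \frac{m}{2} \right \rceil \right \} \leq \chi_{pc}(K_{n,m}) \leq n+m-1 - \left \lfloor \frac{m}{3} \right \rfloor.$$
   Context: All graphs are finite and simple; $\mathbb{N}=\{1,2,3,\ldots\}$. $K_{n,m}$ denotes the complete bipartite graph with partite sets of sizes $n$ and $m$. A list assignment $L$ for a graph $G$ assigns to each vertex $v$ a set $L(v)$ of colors; it is a $k$-assignment if $|L(v)|=k$ for all $v$. The palette is $\mathcal{L}=\bigcup_{v\in V(G)}L(v)$. A proper $L$-coloring is a proper coloring $f$ with $f(v)\in L(v)$ for all $v$. For $c\in\mathcal{L}$, the multiplicity $\eta_L(c)$ (or $\eta(c)$) is the number of vertices $v$ with $c\in L(v)$. If $L$ is a $k$-assignment, a proper $L$-coloring $f$ is a proportional $L$-coloring if for every $c\in\mathcal{L}$, $|f^{-1}(c)|$ equals $\lfloor \eta(c)/k\rfloor$ or $\lceil \eta(c)/k\rceil$. $G$ is proportionally $k$-choosable if it has a proportional $L$-coloring for every $k$-assignment $L$. The proportional choice number $\chi_{pc}(G)$ is the smallest $k$ such that $G$ is proportionally $k$-choosable. *)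

theory Defs
  imports Complex_Main "Graph_Theory.Kuratowski"
begin

text \<open>
  A finite simple graph is a symmetric loop-free digraph without multiple arcs (locale
  \<^locale>\<open>graph\<close>); \<^term>\<open>u \<rightarrow>\<^bsub>G\<^esub> v\<close> is adjacency.
\<close>

definition k_assignment :: "('a, 'b) pre_digraph \<Rightarrow> nat \<Rightarrow> ('a \<Rightarrow> 'c set) \<Rightarrow> bool" where
  "k_assignment G k L \<longleftrightarrow> (\<forall>v \<in> verts G. finite (L v) \<and> card (L v) = k)"

definition palette :: "('a, 'b) pre_digraph \<Rightarrow> ('a \<Rightarrow> 'c set) \<Rightarrow> 'c set" where
  "palette G L = (\<Union>v \<in> verts G. L v)"

definition multiplicity_in :: "('a, 'b) pre_digraph \<Rightarrow> ('a \<Rightarrow> 'c set) \<Rightarrow> 'c \<Rightarrow> nat" where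
  "multiplicity_in G L c = card {v \<in> verts G. c \<in> L v}"

definition proper_list_coloring ::
    "('a, 'b) pre_digraph \<Rightarrow> ('a \<Rightarrow> 'c set) \<Rightarrow> ('a \<Rightarrow> 'c) \<Rightarrow> bool" where
  "proper_list_coloring G L f \<longleftrightarrow>
     (\<forall>v \<in> verts G. f v \<in> L v) \<and> (\<forall>u v. u \<rightarrow>\<^bsub>G\<^esub> v \<longrightarrow> f u \<noteq> f v)"

definition proportional_coloring ::
    "('a, 'b) pre_digraph \<Rightarrow> nat \<Rightarrow> ('a \<Rightarrow> 'c set) \<Rightarrow> ('a \<Rightarrow> 'c) \<Rightarrow> bool" where
  "proportional_coloring G k L f \<longleftrightarrow>
     proper_list_coloring G L f \<and>
     (\<forall>c \<in> palette G L.
        int (card {v \<in> verts G. f v = c}) = \<lfloor>real (multiplicity_in G L c) / real k\<rfloor> \<or>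
        int (card {v \<in> verts G. f v = c}) = \<lceil>real (multiplicity_in G L c) / real k\<rceil>)"

text \<open>
  HOL cannot quantify over the type of colors here. Natural numbers lose no generality: the
  palette of a list assignment for a finite graph is finite and so can be renamed injectively.
\<close>

definition proportionally_choosable :: "('a, 'b) pre_digraph \<Rightarrow> nat \<Rightarrow> bool" where
  "proportionally_choosable G k \<longleftrightarrow>
     (\<forall>L :: 'a \<Rightarrow> nat set. k_assignment G k L \<longrightarrow> (\<exists>f. proportional_coloring G k L f))"

text \<open>
  If no \<open>k\<close> qualified, \<open>LEAST\<close> would be an unspecified number, so a bound on
  \<open>proportional_choice_number G\<close> from above can only be proved by exhibiting such a \<open>k\<close>.
\<close>

definition proportional_choice_number :: "('a, 'b) pre_digraph \<Rightarrow> nat" (\<open>\<chi>\<^sub>p\<^sub>c\<close>) where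
  "\<chi>\<^sub>p\<^sub>c G = (LEAST k. k \<ge> 1 \<and> proportionally_choosable G k)"

end

theory Submission
  imports Defs "HOL-Library.Transitive_Closure_Table"
begin

text \<open>
  Upper bound. Put \<open>k = n + m - 1 - t\<close> with \<open>t = \<lfloor>m / 3\<rfloor>\<close>, so that \<open>\<eta>(c) \<le> n + m < 2 k\<close> and a proportional
  coloring uses a color at least once if \<open>\<eta>(c) \<ge> k\<close>, at most twice if \<open>\<eta>(c) > k\<close>, and at most once
  otherwise. Choosing each color of \<open>L(v)\<close> with weight \<open>1 / k\<close> satisfies these bounds fractionally,
  hence some assignment satisfies them integrally, though perhaps not properly. Take one with the
  fewest colors used on both sides. If \<open>c\<close> is such a color, say at \<open>u\<close> and \<open>v\<close>, then all colors of
  \<open>L(u)\<close> and \<open>L(v)\<close> are in use, and no other vertex can trade its color with the one of \<open>u\<close> and \<open>v\<close>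
  on the opposite side. So each of the other \<open>n + m - 2\<close> vertices misses \<open>c\<close> in its list, shares its
  color with another one, or has a color outside \<open>L(u)\<close> or \<open>L(v)\<close>. With \<open>r\<close> colors in use there are at most \<open>t\<close>,
  \<open>2 (n + m - r) - 2\<close> and \<open>2 (r - k)\<close> of these, at most \<open>3 t\<close> in total. This leaves only the case
  \<open>n = 2\<close>, \<open>m = 3 t\<close> with all estimates sharp, where a color can be freed or three colors rotated.

  Lower bounds. For \<open>k \<le> n\<close>, give \<open>k\<close> vertices on one side the list \<open>{0} \<union> B\<close>, \<open>k\<close> vertices on the other
  the list \<open>{0} \<union> C\<close>, and all further vertices colors outside \<open>{0} \<union> B \<union> C\<close>. Color 0 is used on at most one
  of the sides, so on the other one \<open>k - 1\<close> colors, each used exactly once, must serve \<open>k\<close> vertices.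
  For \<open>k < \<lceil>n / 2\<rceil> + \<lceil>m / 2\<rceil>\<close>, choose odd \<open>a \<le> n\<close> and \<open>b \<le> m\<close> with \<open>a + b = 2 k\<close> and give \<open>a + b\<close> vertices
  the same list, used by no other vertex. Each of its colors is used exactly twice, on one side,
  so \<open>a\<close> would be even.
\<close>

subsection \<open>Assignments with prescribed bounds on color usage\<close>

definition uses :: "'a set \<Rightarrow> ('a \<Rightarrow> 'c) \<Rightarrow> 'c \<Rightarrow> nat" where
  "uses W g x = card {w \<in> W. g w = x}"

text \<open>Putting indicator terms on both sides avoids truncated subtraction and covers
  \<open>y = g a\<close> without a case split.\<close>

lemma uses_fun_upd:
  assumes "finite W" "a \<in> W"
  shows "uses W (g(a := y)) x + of_bool (g a = x) = uses W g x + of_bool (y = x)"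
proof -
  have *: "uses W h x = uses (W - {a}) h x + of_bool (h a = x)" for h
  proof -
    have "{w \<in> W. h w = x} = {w \<in> W - {a}. h w = x} \<union> (if h a = x then {a} else {})"
      using assms by auto
    then show ?thesis using assms(1) by (simp add: uses_def)
  qed
  have "uses (W - {a}) (g(a := y)) x = uses (W - {a}) g x"
    unfolding uses_def by (rule arg_cong[where f = card]) auto
  then show ?thesis using *[of "g(a := y)"] *[of g] by simp
qed

lemma sum_uses:
  assumes "finite W" "finite R"
  shows "(\<Sum>x\<in>R. uses W g x) = card {w \<in> W. g w \<in> R}"
proof -
  have "{w \<in> W. g w \<in> R} = (\<Union>x\<in>R. {w \<in> W. g w = x})" by auto
  then show ?thesis
    using assms unfolding uses_def by (simp add: card_UN_disjoint disjoint_iff)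
qed

lemma sum_multiplicity:
  assumes "finite W" "finite R"
  shows "(\<Sum>x\<in>R. card {w \<in> W. x \<in> L w}) = (\<Sum>w\<in>W. card (L w \<inter> R))"
proof -
  have "(\<Sum>x\<in>R. card {w \<in> W. x \<in> L w}) = (\<Sum>w\<in>W. card {x \<in> R. x \<in> L w})"
    by (rule sum_multicount_gen) (use assms in auto)
  also have "\<dots> = (\<Sum>w\<in>W. card (L w \<inter> R))"
    by (intro sum.cong arg_cong[where f = card]) auto
  finally show ?thesis .
qed

text \<open>Induction shifts the tail of the path first. Vertices colored off the tail are untouched
  and the colors are distinct, so \<open>w\<close> still has color \<open>x\<close> and can pass to
  \<open>x1\<close>. Gains and losses at inner colors cancel.\<close>

lemma shift_along_path:
  assumes "rtrancl_path (\<lambda>x y. \<exists>w\<in>W. g w = x \<and> y \<in> L w) x xs y" "distinct (x # xs)"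
    and "finite W" "\<forall>w\<in>W. g w \<in> L w"
  shows "\<exists>g'. (\<forall>w\<in>W. g' w \<in> L w) \<and> (\<forall>w. g w \<notin> set (x # xs) \<longrightarrow> g' w = g w) \<and>
    (\<forall>z. uses W g' z + of_bool (x = z) = uses W g z + of_bool (y = z))"
  using assms(1,2)
proof (induction rule: rtrancl_path.induct)
  case (base x)
  then show ?case using assms(4) by (intro exI[of _ g]) auto
next
  case (step x x1 xs y)
  then obtain w where w: "w \<in> W" "g w = x" "x1 \<in> L w" by blast
  from step obtain g' where g': "\<forall>w\<in>W. g' w \<in> L w" "\<forall>w. g w \<notin> set (x1 # xs) \<longrightarrow> g' w = g w"
    "\<And>z. uses W g' z + of_bool (x1 = z) = uses W g z + of_bool (y = z)" by auto
  have "g' w = x" using g'(2) w step.prems by auto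
  then have "uses W (g'(w := x1)) z + of_bool (x = z) = uses W g z + of_bool (y = z)" for z
    using uses_fun_upd[OF assms(3) w(1), of g' x1 z] g'(3)[of z] by simp
  moreover have "\<forall>v\<in>W. (g'(w := x1)) v \<in> L v" using g'(1) w by simp
  moreover have "\<forall>v. g v \<notin> set (x # x1 # xs) \<longrightarrow> (g'(w := x1)) v = g v" using g'(2) w by auto
  ultimately show ?case by blast
qed

text \<open>
  The assignment minimizes the total violation of the bounds. Unless it is 0, the set of colors that
  can be reached from (or can reach) a violating color by recoloring one vertex at a time contradicts
  double counting of the pairs of a vertex and a color of its list.
\<close>

lemma exists_assignment_between:
  fixes L :: "'a \<Rightarrow> 'c set"
  assumes W: "finite W" and L: "\<And>w. w \<in> W \<Longrightarrow> finite (L w) \<and> card (L w) = k" and "0 < k"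
    and lo: "\<And>x. k * lo x \<le> card {w \<in> W. x \<in> L w}"
    and hi: "\<And>x. card {w \<in> W. x \<in> L w} \<le> k * hi x"
  obtains g where "\<And>w. w \<in> W \<Longrightarrow> g w \<in> L w" "\<And>x. lo x \<le> uses W g x" "\<And>x. uses W g x \<le> hi x"
proof -
  define P where "P = (\<Union>w\<in>W. L w)"
  define defect where
    "defect g = (\<Sum>x\<in>P. (uses W g x - hi x) + (lo x - uses W g x))" for g
  have P: "finite P" using W L by (simp add: P_def)
  have lohi: "lo x \<le> hi x" for x
    using order_trans[OF lo[of x] hi[of x]] \<open>0 < k\<close> by simp
  have "\<forall>w\<in>W. L w \<noteq> {}" using L \<open>0 < k\<close> by fastforce
  then have "\<forall>w\<in>W. (SOME x. x \<in> L w) \<in> L w" by (simp add: some_in_eq)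
  then obtain g where g: "\<forall>w\<in>W. g w \<in> L w"
    and least: "\<And>g'. \<forall>w\<in>W. g' w \<in> L w \<Longrightarrow> defect g \<le> defect g'"
    using ex_has_least_nat[of "\<lambda>g. \<forall>w\<in>W. g w \<in> L w" "\<lambda>w. SOME x. x \<in> L w" defect] by blast
  define E where "E = (\<lambda>x y. \<exists>w\<in>W. g w = x \<and> y \<in> L w)"
  have no_shift: False
    if E: "E\<^sup>*\<^sup>* x y" and xy: "x \<in> P" "y \<in> P"
      and c: "hi x < uses W g x \<and> uses W g y < hi y \<or> lo x < uses W g x \<and> uses W g y < lo y" for x y
  proof -
    have "x \<noteq> y" using c by auto
    from E obtain xs where "rtrancl_path E x xs y" "distinct (x # xs)"
      by (metis rtranclp_eq_rtrancl_path rtrancl_path_distinct)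
    then obtain g' where g': "\<forall>w\<in>W. g' w \<in> L w"
      and u: "\<And>z. uses W g' z + of_bool (x = z) = uses W g z + of_bool (y = z)"
      using shift_along_path[of W g L x xs y] W g unfolding E_def by blast
    have "defect g' < defect g" unfolding defect_def
    proof (rule sum_strict_mono_ex1[OF P])
      have ux: "uses W g' x + 1 = uses W g x" using u[of x] \<open>x \<noteq> y\<close> by simp
      have uy: "uses W g' y = uses W g y + 1" using u[of y] \<open>x \<noteq> y\<close> by simp
      \<comment> \<open>Because \<open>lo\<close> is at most \<open>hi\<close>, losing a use gives
        \<open>x\<close> no new deficit and gaining one gives \<open>y\<close> no new excess, so the
        drop in the excess of \<open>x\<close> or the deficit of \<open>y\<close> is not
        offset.\<close>
      have strict: "uses W g' x - hi x + (lo x - uses W g' x) + (uses W g' y - hi y + (lo y - uses W g' y))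
          < uses W g x - hi x + (lo x - uses W g x) + (uses W g y - hi y + (lo y - uses W g y))"
        using c ux uy lohi[of x] lohi[of y] by linarith
      have le: "uses W g' x - hi x + (lo x - uses W g' x) \<le> uses W g x - hi x + (lo x - uses W g x)"
        "uses W g' y - hi y + (lo y - uses W g' y) \<le> uses W g y - hi y + (lo y - uses W g y)"
        using c ux uy lohi[of x] lohi[of y] by linarith+
      show "\<forall>z\<in>P. uses W g' z - hi z + (lo z - uses W g' z) \<le> uses W g z - hi z + (lo z - uses W g z)"
      proof
        fix z assume "z \<in> P"
        show "uses W g' z - hi z + (lo z - uses W g' z) \<le> uses W g z - hi z + (lo z - uses W g z)"
          using le u[of z] by (cases "z = x"; cases "z = y") auto
      qed
      show "\<exists>z\<in>P. uses W g' z - hi z + (lo z - uses W g' z) < uses W g z - hi z + (lo z - uses W g z)"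
        using strict xy by (meson add_mono not_le)
    qed
    with least[OF g'] show False by simp
  qed
  have "uses W g x \<le> hi x" for x
  proof (rule ccontr)
    assume "\<not> uses W g x \<le> hi x"
    then have x: "hi x < uses W g x" by simp
    define R where "R = {y. E\<^sup>*\<^sup>* x y}"
    have "{w \<in> W. g w = x} \<noteq> {}" using x unfolding uses_def by (metis card.empty not_less0)
    then have "x \<in> P" using g by (auto simp: P_def)
    have "y \<in> P" if "E\<^sup>*\<^sup>* x y" for y
      using that \<open>x \<in> P\<close> by (induction) (auto simp: E_def P_def)
    then have RP: "R \<subseteq> P" by (auto simp: R_def)
    then have R: "finite R" using P finite_subset by blast
    have ge: "hi y \<le> uses W g y" if "y \<in> R" for y
      using no_shift[of x y] x that RP \<open>x \<in> P\<close> by (force simp: R_def)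
    have "x \<in> R" by (simp add: R_def)
    have *: "(\<Sum>y\<in>R. hi y) < (\<Sum>y\<in>R. uses W g y)"
      by (rule sum_strict_mono_ex1[OF R]) (use ge x \<open>x \<in> R\<close> in auto)
    \<comment> \<open>\<open>R\<close> is closed under recoloring, so a vertex colored in
      \<open>R\<close> contributes its whole list, \<open>k\<close> pairs, to the double
      count.\<close>
    have sub: "L w \<subseteq> R" if "w \<in> W" "g w \<in> R" for w
      using that by (auto simp: R_def E_def intro: rtranclp.rtrancl_into_rtrancl)
    have "k * (\<Sum>y\<in>R. uses W g y) = (\<Sum>w\<in>{w \<in> W. g w \<in> R}. k)"
      by (simp add: sum_uses[OF W R])
    also have "\<dots> = (\<Sum>w\<in>{w \<in> W. g w \<in> R}. card (L w \<inter> R))"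
      by (intro sum.cong) (use sub L in \<open>auto simp: Int_absorb2\<close>)
    also have "\<dots> \<le> (\<Sum>w\<in>W. card (L w \<inter> R))"
      by (rule sum_mono2) (use W in auto)
    also have "\<dots> = (\<Sum>y\<in>R. card {w \<in> W. y \<in> L w})"
      by (rule sum_multiplicity[OF W R, symmetric])
    also have "\<dots> \<le> k * (\<Sum>y\<in>R. hi y)"
      using hi by (simp add: sum_distrib_left sum_mono)
    finally show False using * \<open>0 < k\<close> by simp
  qed
  moreover have "lo x \<le> uses W g x" for x
  proof (rule ccontr)
    assume "\<not> lo x \<le> uses W g x"
    then have x: "uses W g x < lo x" by simp
    define R where "R = {y. E\<^sup>*\<^sup>* y x}"
    have "0 < k * lo x" using x \<open>0 < k\<close> by simp
    then have "{w \<in> W. x \<in> L w} \<noteq> {}" using lo[of x] by (metis card.empty not_le)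
    then have "x \<in> P" by (auto simp: P_def)
    have "y \<in> P" if "E\<^sup>*\<^sup>* y x" for y
      using that \<open>x \<in> P\<close> by (induction rule: converse_rtranclp_induct) (use g in \<open>auto simp: E_def P_def\<close>)
    then have RP: "R \<subseteq> P" by (auto simp: R_def)
    then have R: "finite R" using P finite_subset by blast
    have le: "uses W g y \<le> lo y" if "y \<in> R" for y
      using no_shift[of y x] x that RP \<open>x \<in> P\<close> by (force simp: R_def)
    have "x \<in> R" by (simp add: R_def)
    have *: "(\<Sum>y\<in>R. uses W g y) < (\<Sum>y\<in>R. lo y)"
      by (rule sum_strict_mono_ex1[OF R]) (use le x \<open>x \<in> R\<close> in auto)
    \<comment> \<open>Dually, \<open>R\<close> is closed under predecessors: only vertices colored
      in \<open>R\<close> have colors of \<open>R\<close> in their lists, at most \<open>k\<close>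
      each.\<close>
    have sub: "g w \<in> R" if "w \<in> W" "y \<in> L w" "y \<in> R" for w y
      using that by (auto simp: R_def E_def intro: converse_rtranclp_into_rtranclp)
    have "k * (\<Sum>y\<in>R. lo y) \<le> (\<Sum>y\<in>R. card {w \<in> W. y \<in> L w})"
      using lo by (simp add: sum_distrib_left sum_mono)
    also have "\<dots> = (\<Sum>w\<in>W. card (L w \<inter> R))" by (rule sum_multiplicity[OF W R])
    also have "\<dots> = (\<Sum>w\<in>{w \<in> W. g w \<in> R}. card (L w \<inter> R))"
      by (rule sum.mono_neutral_right) (use W sub in \<open>auto simp: card_eq_0_iff\<close>)
    also have "\<dots> \<le> (\<Sum>w\<in>{w \<in> W. g w \<in> R}. k)"
      by (intro sum_mono) (metis (no_types, lifting) L card_mono Int_lower1 mem_Collect_eq)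
    also have "\<dots> = k * (\<Sum>y\<in>R. uses W g y)"
      by (simp add: sum_uses[OF W R])
    finally show False using * \<open>0 < k\<close> by simp
  qed
  ultimately show thesis using that g by blast
qed

subsection \<open>Removing colors used on both sides\<close>

definition conflicts :: "'a set \<Rightarrow> 'a set \<Rightarrow> ('a \<Rightarrow> 'c) \<Rightarrow> 'c set" where
  "conflicts U V g = g ` U \<inter> g ` V"

text \<open>A count may become 1 because every lower bound in question is at most 1 and every upper
  bound at least 1. So the bounds survive while the set of conflicts strictly shrinks.\<close>

definition improves ::
    "'a set \<Rightarrow> 'a set \<Rightarrow> ('a \<Rightarrow> 'c set) \<Rightarrow> ('a \<Rightarrow> 'c) \<Rightarrow> ('a \<Rightarrow> 'c) \<Rightarrow> bool" where
  "improves U V L g g' \<longleftrightarrow> (\<forall>w\<in>U \<union> V. g' w \<in> L w) \<and>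
     (\<forall>x. uses (U \<union> V) g' x = uses (U \<union> V) g x \<or> uses (U \<union> V) g' x = 1) \<and>
     conflicts U V g' \<subset> conflicts U V g"

lemma conflictsI: "a \<in> U \<Longrightarrow> b \<in> V \<Longrightarrow> g a = x \<Longrightarrow> g b = x \<Longrightarrow> x \<in> conflicts U V g"
  unfolding conflicts_def by (metis IntI imageI)

lemma improves_commute: "improves U V L g g' = improves V U L g g'"
  by (simp add: improves_def conflicts_def Un_commute Int_commute)

text \<open>With at most two uses per color, a conflicting color sits at exactly one vertex of each
  side. The setting is symmetric in the sides, so every move at \<open>u\<close> also serves at
  \<open>v\<close>, via \<open>swapped\<close>.\<close>

locale conflict =
  fixes U V :: "'a set" and L :: "'a \<Rightarrow> 'c set" and g :: "'a \<Rightarrow> 'c" and u v :: 'a and c :: 'c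
  assumes fin: "finite U" "finite V" and disj: "U \<inter> V = {}"
    and g: "\<And>w. w \<in> U \<union> V \<Longrightarrow> g w \<in> L w"
    and uv: "u \<in> U" "v \<in> V"
    and fiber: "{w \<in> U \<union> V. g w = c} = {u, v}"
begin

lemma gc: "g u = c" "g v = c" "u \<noteq> v" "u \<notin> V" "v \<notin> U"
  using uv fiber disj by blast+

lemma only_c: "w \<in> U \<union> V \<Longrightarrow> g w = c \<Longrightarrow> w = u \<or> w = v"
  using fiber by blast

lemma c_conflict: "c \<in> conflicts U V g"
  using conflictsI[OF uv gc(1,2)] .

lemma uses_c: "uses (U \<union> V) g c = 2"
  unfolding uses_def fiber using gc(3) by simp

lemma swapped: "conflict V U L g v u c"
  using fin disj g uv fiber by unfold_locales (auto simp: Un_commute insert_commute)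

section \<open>Recoloring moves that resolve a conflict\<close>

lemma improves_by:
  assumes "\<And>w. w \<in> U \<union> V \<Longrightarrow> g' w \<in> L w"
    and "\<And>x. uses (U \<union> V) g' x = uses (U \<union> V) g x \<or> uses (U \<union> V) g' x = 1"
    and "conflicts U V g' \<subseteq> conflicts U V g - {c}"
  shows "improves U V L g g'"
  using assms c_conflict unfolding improves_def by blast

lemma single_neq:
  assumes "\<And>w'. w' \<in> U \<union> V \<Longrightarrow> g w' = g w \<Longrightarrow> w' = w"
  shows "g w \<noteq> c" "w \<noteq> u" "w \<noteq> v"
proof -
  show "g w \<noteq> c"
  proof
    assume "g w = c"
    then have "u = w" "v = w" using assms[of u] assms[of v] uv gc(1,2) by simp_all
    then show False using gc(3) by simp
  qed
  then show "w \<noteq> u" "w \<noteq> v" using gc(1,2) by metis+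
qed

text \<open>\<open>c\<close> drops to one use and \<open>z\<close> rises to one, at \<open>u\<close>
  alone, so no new conflict can arise.\<close>

lemma recolor_unused:
  assumes "z \<in> L u" "z \<notin> g ` (U \<union> V)"
  shows "improves U V L g (g(u := z))"
proof -
  let ?g = "g(u := z)"
  have z0: "uses (U \<union> V) g z = 0" using assms(2) by (auto simp: uses_def card_eq_0_iff)
  have "z \<noteq> c" using assms(2) uv gc by blast
  have "uses (U \<union> V) ?g x = uses (U \<union> V) g x \<or> uses (U \<union> V) ?g x = 1" for x
  proof -
    have "uses (U \<union> V) ?g x + of_bool (c = x) = uses (U \<union> V) g x + of_bool (z = x)"
      using uses_fun_upd[of "U \<union> V" u g z x] fin uv(1) gc(1) by simp
    then show ?thesis using z0 uses_c \<open>z \<noteq> c\<close> by (cases "c = x"; cases "z = x") auto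
  qed
  moreover have "conflicts U V ?g \<subseteq> conflicts U V g - {c}"
  proof
    fix x assume "x \<in> conflicts U V ?g"
    then obtain a b where ab: "a \<in> U" "b \<in> V" "?g a = x" "?g b = x"
      by (auto simp: conflicts_def)
    have "b \<noteq> u" using ab gc by auto
    then have b: "g b = x" using ab by auto
    then have "x \<noteq> z" using assms(2) ab by blast
    then have "a \<noteq> u" using ab by auto
    then have a: "g a = x" using ab by auto
    have "x \<noteq> c" using only_c[of a] a \<open>a \<noteq> u\<close> ab(1) gc by auto
    show "x \<in> conflicts U V g - {c}" using conflictsI[OF ab(1,2) a b] \<open>x \<noteq> c\<close> by simp
  qed
  moreover have "?g w' \<in> L w'" if "w' \<in> U \<union> V" for w'
    using that g assms(1) by simp
  ultimately show ?thesis by (intro improves_by)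
qed

lemma recolor_unused_via:
  assumes w: "w \<in> U \<union> V" "\<And>w'. w' \<in> U \<union> V \<Longrightarrow> g w' = g w \<Longrightarrow> w' = w" "g w \<in> L u"
    and z: "z \<in> L w" "z \<notin> g ` (U \<union> V)"
  shows "improves U V L g (g(w := z, u := g w))"
proof -
  let ?g = "g(w := z, u := g w)"
  have z0: "uses (U \<union> V) g z = 0" using z by (auto simp: uses_def card_eq_0_iff)
  have ne: "w \<noteq> u" "w \<noteq> v" "g w \<noteq> c" using single_neq[OF w(2)] by simp_all
  have "z \<noteq> c" "z \<noteq> g w" using z w(1) uv gc by blast+
  have "uses (U \<union> V) ?g x = uses (U \<union> V) g x \<or> uses (U \<union> V) ?g x = 1" for x
  proof -
    have "uses (U \<union> V) (g(w := z)) x + of_bool (g w = x) = uses (U \<union> V) g x + of_bool (z = x)"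
      using uses_fun_upd[of "U \<union> V" w g z x] fin w(1) by simp
    moreover have "uses (U \<union> V) ?g x + of_bool (c = x) = uses (U \<union> V) (g(w := z)) x + of_bool (g w = x)"
      using uses_fun_upd[of "U \<union> V" u "g(w := z)" "g w" x] fin uv(1) gc(1) ne(1) by simp
    ultimately have "uses (U \<union> V) ?g x + of_bool (c = x) = uses (U \<union> V) g x + of_bool (z = x)"
      by linarith
    then show ?thesis using z0 uses_c \<open>z \<noteq> c\<close> by (cases "c = x"; cases "z = x") auto
  qed
  moreover have "conflicts U V ?g \<subseteq> conflicts U V g - {c}"
  proof
    fix x assume "x \<in> conflicts U V ?g"
    then obtain a b where ab: "a \<in> U" "b \<in> V" "?g a = x" "?g b = x"
      by (auto simp: conflicts_def)
    have "b \<noteq> u" using ab gc by auto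
    have "x \<noteq> z" using ab z \<open>z \<noteq> g w\<close> \<open>b \<noteq> u\<close> disj by (auto split: if_splits)
    then have "b \<noteq> w" using ab \<open>b \<noteq> u\<close> by auto
    then have b: "g b = x" using ab \<open>b \<noteq> u\<close> by auto
    have "x \<noteq> g w" using w(2)[of b] b \<open>b \<noteq> w\<close> ab by auto
    then have "a \<noteq> u" using ab by auto
    then have a: "g a = x" using ab \<open>x \<noteq> z\<close> by (auto split: if_splits)
    have "x \<noteq> c" using only_c[of a] a \<open>a \<noteq> u\<close> ab(1) gc by auto
    show "x \<in> conflicts U V g - {c}" using conflictsI[OF ab(1,2) a b] \<open>x \<noteq> c\<close> by simp
  qed
  moreover have "?g w' \<in> L w'" if "w' \<in> U \<union> V" for w'
    using that g z(1) w(3) by simp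
  ultimately show ?thesis by (intro improves_by)
qed

text \<open>\<open>u\<close> and \<open>w\<close> exchange colors, so all counts stay. Both uses of
  \<open>c\<close> are then in \<open>V\<close>, and \<open>g w\<close> is used at \<open>u\<close>
  only.\<close>

lemma swap_across:
  assumes w: "w \<in> V" "\<And>w'. w' \<in> U \<union> V \<Longrightarrow> g w' = g w \<Longrightarrow> w' = w" "g w \<in> L u" "c \<in> L w"
  shows "improves U V L g (g(w := c, u := g w))"
proof -
  let ?g = "g(w := c, u := g w)"
  have ne: "w \<noteq> u" "w \<noteq> v" "g w \<noteq> c" using single_neq[OF w(2)] by simp_all
  have "uses (U \<union> V) ?g x = uses (U \<union> V) g x" for x
  proof -
    have "uses (U \<union> V) (g(w := c)) x + of_bool (g w = x) = uses (U \<union> V) g x + of_bool (c = x)"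
      using uses_fun_upd[of "U \<union> V" w g c x] fin w(1) by simp
    moreover have "uses (U \<union> V) ?g x + of_bool (c = x) = uses (U \<union> V) (g(w := c)) x + of_bool (g w = x)"
      using uses_fun_upd[of "U \<union> V" u "g(w := c)" "g w" x] fin uv(1) gc(1) ne(1) by simp
    ultimately show ?thesis by linarith
  qed
  moreover have "conflicts U V ?g \<subseteq> conflicts U V g - {c}"
  proof
    fix x assume "x \<in> conflicts U V ?g"
    then obtain a b where ab: "a \<in> U" "b \<in> V" "?g a = x" "?g b = x"
      by (auto simp: conflicts_def)
    have "b \<noteq> u" "a \<noteq> w" using ab gc w disj by auto
    have "a \<noteq> u"
    proof
      assume "a = u"
      then have "x = g w" using ab by simp
      then have "b \<noteq> w" "g b = g w" using ab \<open>b \<noteq> u\<close> ne by (auto split: if_splits)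
      then show False using w(2)[of b] ab by auto
    qed
    then have a: "g a = x" using ab \<open>a \<noteq> w\<close> by auto
    have "x \<noteq> c" using only_c[of a] a \<open>a \<noteq> u\<close> ab(1) gc by auto
    then have b: "g b = x" using ab \<open>b \<noteq> u\<close> by (auto split: if_splits)
    show "x \<in> conflicts U V g - {c}" using conflictsI[OF ab(1,2) a b] \<open>x \<noteq> c\<close> by simp
  qed
  moreover have "?g w' \<in> L w'" if "w' \<in> U \<union> V" for w'
    using that g w(3,4) by simp
  ultimately show ?thesis by (intro improves_by disjI1)
qed

text \<open>The 3-cycle puts both uses of \<open>c\<close> into \<open>U\<close>, at
  \<open>u\<close> and \<open>u'\<close>, and the colors \<open>g w\<close> and \<open>g u'\<close>
  into \<open>V\<close>, with one use each. It serves where a plain exchange of \<open>u'\<close>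
  and \<open>v\<close> fails because \<open>g u'\<close> is not in \<open>L v\<close>.\<close>

lemma rotate:
  assumes u': "u' \<in> U" "\<And>w'. w' \<in> U \<union> V \<Longrightarrow> g w' = g u' \<Longrightarrow> w' = u'" "c \<in> L u'"
    and w: "w \<in> V" "\<And>w'. w' \<in> U \<union> V \<Longrightarrow> g w' = g w \<Longrightarrow> w' = w" "g w \<in> L v" "g u' \<in> L w"
  shows "improves U V L g (g(u' := c, v := g w, w := g u'))"
proof -
  let ?g = "g(u' := c, v := g w, w := g u')"
  have ne: "w \<noteq> u" "w \<noteq> v" "g w \<noteq> c" "u' \<noteq> u" "u' \<noteq> v" "g u' \<noteq> c"
    using single_neq[OF w(2)] single_neq[OF u'(2)] by simp_all
  have ne2: "u' \<noteq> w" "g u' \<noteq> g w" using u' w disj by auto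
  have "uses (U \<union> V) ?g x = uses (U \<union> V) g x" for x
  proof -
    have "uses (U \<union> V) (g(u' := c)) x + of_bool (g u' = x) = uses (U \<union> V) g x + of_bool (c = x)"
      using uses_fun_upd[of "U \<union> V" u' g c x] fin u'(1) by simp
    moreover have "uses (U \<union> V) (g(u' := c, v := g w)) x + of_bool (c = x)
        = uses (U \<union> V) (g(u' := c)) x + of_bool (g w = x)"
      using uses_fun_upd[of "U \<union> V" v "g(u' := c)" "g w" x] fin uv(2) gc(2) ne(5) by simp
    moreover have "uses (U \<union> V) ?g x + of_bool (g w = x)
        = uses (U \<union> V) (g(u' := c, v := g w)) x + of_bool (g u' = x)"
      using uses_fun_upd[of "U \<union> V" w "g(u' := c, v := g w)" "g u'" x] fin w(1) ne(2) ne2 by simp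
    ultimately show ?thesis by linarith
  qed
  moreover have "conflicts U V ?g \<subseteq> conflicts U V g - {c}"
  proof
    fix x assume "x \<in> conflicts U V ?g"
    then obtain a b where ab: "a \<in> U" "b \<in> V" "?g a = x" "?g b = x"
      by (auto simp: conflicts_def)
    have n: "b \<noteq> u'" "a \<noteq> w" "a \<noteq> v" using ab gc u' w disj by auto
    have "x \<noteq> c"
    proof
      assume "x = c"
      then have "g b = c" "b \<noteq> v" using ab n ne by (auto split: if_splits)
      then show False using only_c[of b] ab gc by auto
    qed
    then have "a \<noteq> u'" using ab n by auto
    then have a: "g a = x" using ab n by auto
    have "b \<noteq> v" using w(2)[of a] a ab n ne by auto
    have "b \<noteq> w" using u'(2)[of a] a ab \<open>a \<noteq> u'\<close> by auto
    have b: "g b = x" using ab n \<open>b \<noteq> v\<close> \<open>b \<noteq> w\<close> by auto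
    show "x \<in> conflicts U V g - {c}" using conflictsI[OF ab(1,2) a b] \<open>x \<noteq> c\<close> by simp
  qed
  moreover have "?g w' \<in> L w'" if "w' \<in> U \<union> V" for w'
    using that g u'(3) w(3,4) by simp
  ultimately show ?thesis by (intro improves_by disjI1)
qed

text \<open>If no move applies, \<open>M\<close> and \<open>R\<close> cover
  \<open>W - {u, v}\<close>, with at most \<open>t\<close> and
  \<open>2 * (card W - k) - 2 = 2 * t\<close> elements. As \<open>card W - 2\<close> is at least
  \<open>3 * t\<close>, only equality survives; there \<open>tight\<close> leaves
  \<open>card U = 2\<close> and a vertex missing \<open>c\<close>, which allows a rotation.\<close>

lemma improvable:
  assumes le2: "\<And>x. uses (U \<union> V) g x \<le> 2"
    and L: "\<And>w. w \<in> U \<union> V \<Longrightarrow> finite (L w) \<and> card (L w) = k"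
    and missing: "card {w \<in> U \<union> V. c \<notin> L w} \<le> t"
    and size: "card U + card V = k + 1 + t" "3 * t + 2 \<le> card U + card V"
    and tight: "card U + card V = 3 * t + 2 \<Longrightarrow> card U = 2 \<and> 0 < t"
  shows "\<exists>g'. improves U V L g g'"
proof (rule ccontr)
  assume no: "\<nexists>g'. improves U V L g g'"
  interpret sw: conflict V U L g v u c by (rule swapped)
  have no': "\<nexists>g'. improves V U L g g'" using no improves_commute by metis
  define W where "W = U \<union> V"
  define A where "A = g ` W"
  define S where "S = {w \<in> W. uses W g (g w) = 1}"
  define D where "D = {w \<in> W. uses W g (g w) = 2}"
  define M where "M = {w \<in> W. c \<notin> L w}"
  \<comment> \<open>\<open>Nu\<close> and \<open>Nv\<close> collect the sole carriers whose color
    cannot be handed to the conflict vertex on the opposite side.\<close>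
  define Nu where "Nu = {w \<in> V \<inter> S. g w \<notin> L u}"
  define Nv where "Nv = {w \<in> U \<inter> S. g w \<notin> L v}"
  have W: "finite W" and UV: "U \<union> V = W" "V \<union> U = W" using fin by (auto simp: W_def)
  have W_iff: "w \<in> W \<longleftrightarrow> w \<in> U \<or> w \<in> V" for w by (simp add: W_def)
  note g = g[unfolded UV] and L = L[unfolded UV] and le2 = le2[unfolded UV]
    and missing = missing[unfolded UV] and uses_c = uses_c[unfolded UV]
  note moves = recolor_unused[unfolded UV] recolor_unused_via[unfolded UV] swap_across[unfolded UV]
    and sw_moves = sw.recolor_unused[unfolded UV] sw.recolor_unused_via[unfolded UV]
      sw.swap_across[unfolded UV]
  have cW: "card W = card U + card V" using fin disj by (simp add: W_def card_Un_disjoint)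
  have fA: "finite A" and fS: "finite S" and fD: "finite D" and fM: "finite M"
    using W by (auto simp: A_def S_def D_def M_def)
  have fN: "finite Nu" "finite Nv" using fS by (auto simp: Nu_def Nv_def)
  have Lu: "L u \<subseteq> A" using moves(1) no by (auto simp: A_def)
  have Lv: "L v \<subseteq> A" using sw_moves(1) no' by (auto simp: A_def)
  have uW: "u \<in> W" "v \<in> W" using uv by (auto simp: W_iff)
  have kA: "k \<le> card A" using Lu L[of u] uW fA by (auto intro: card_mono)
  have single: "w' = w" if "w \<in> S" "w' \<in> W" "g w' = g w" for w w'
  proof -
    have "card {y \<in> W. g y = g w} = 1" using that(1) by (simp add: S_def uses_def)
    then obtain a where "{y \<in> W. g y = g w} = {a}" by (auto simp: card_1_singleton_iff)
    moreover have "w \<in> {y \<in> W. g y = g w}" "w' \<in> {y \<in> W. g y = g w}"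
      using that by (auto simp: S_def)
    ultimately show ?thesis by (metis singletonD)
  qed
  have ge1: "1 \<le> uses W g (g w)" if "w \<in> W" for w
  proof -
    have "{y \<in> W. g y = g w} \<noteq> {}" using that by blast
    then have "card {y \<in> W. g y = g w} > 0" using W by (simp add: card_gt_0_iff)
    then show ?thesis by (simp add: uses_def)
  qed
  have WSD: "W = S \<union> D"
  proof -
    have "uses W g (g w) = 1 \<or> uses W g (g w) = 2" if "w \<in> W" for w
      using ge1[OF that] le2[of "g w"] by (simp, linarith)
    then show ?thesis by (auto simp: S_def D_def)
  qed
  have SD: "S \<inter> D = {}" by (auto simp: S_def D_def)
  have cWSD: "card W = card S + card D" unfolding WSD by (rule card_Un_disjoint[OF fS fD SD])
  have gSD: "g ` S \<inter> g ` D = {}" by (auto simp: S_def D_def)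
  have "card A = card (g ` S) + card (g ` D)"
    unfolding A_def WSD image_Un using gSD fS fD by (simp add: card_Un_disjoint)
  moreover have "card (g ` S) = card S"
    by (rule card_image, rule inj_onI) (use single in \<open>auto simp: S_def\<close>)
  moreover have "2 * card (g ` D) = card D"
  proof -
    have "2 * card (g ` D) = (\<Sum>x\<in>g ` D. 2)" by simp
    also have "\<dots> = (\<Sum>x\<in>g ` D. uses W g x)"
    proof (rule sum.cong)
      fix x assume "x \<in> g ` D"
      then obtain w where "x = g w" "w \<in> D" by blast
      then show "2 = uses W g x" unfolding D_def by simp
    qed simp
    also have "\<dots> = card {w \<in> W. g w \<in> g ` D}" using W fD by (simp add: sum_uses)
    also have "{w \<in> W. g w \<in> g ` D} = D" by (auto simp: D_def)
    finally show ?thesis .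
  qed
  \<comment> \<open>\<open>D\<close> has two vertices per color, so \<open>card A\<close> is
    \<open>card S\<close> plus half of \<open>card D\<close>.\<close>
  ultimately have cD: "card D + 2 * card A = 2 * card W" using cWSD by linarith
  have cNu: "card Nu \<le> card A - k"
  proof -
    have "card Nu = card (g ` Nu)"
      by (rule card_image[symmetric], rule inj_onI) (use single in \<open>auto simp: Nu_def S_def\<close>)
    also have "\<dots> \<le> card (A - L u)"
      by (rule card_mono) (use fA in \<open>auto simp: Nu_def A_def S_def\<close>)
    also have "\<dots> = card A - k" using L[of u] uW Lu by (simp add: card_Diff_subset)
    finally show ?thesis .
  qed
  have cNv: "card Nv \<le> card A - k"
  proof -
    have "card Nv = card (g ` Nv)"
      by (rule card_image[symmetric], rule inj_onI) (use single in \<open>auto simp: Nv_def S_def\<close>)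
    also have "\<dots> \<le> card (A - L v)"
      by (rule card_mono) (use fA in \<open>auto simp: Nv_def A_def S_def\<close>)
    also have "\<dots> = card A - k" using L[of v] uW Lv by (simp add: card_Diff_subset)
    finally show ?thesis .
  qed
  have uvD: "u \<in> D" "v \<in> D" using uW uses_c gc by (auto simp: D_def)
  have cD2: "card (D - {u, v}) = card D - 2" "2 \<le> card D"
    using uvD fD gc(3) card_mono[of D "{u, v}"] by (auto simp: card_Diff_subset)
  \<comment> \<open>Otherwise \<open>swap_across\<close> would improve \<open>g\<close>. So a sole
    carrier with \<open>c\<close> in its list lies in \<open>Nu\<close> or
    \<open>Nv\<close>.\<close>
  have sV: "g w \<notin> L u" if "w \<in> V" "w \<in> S" "c \<in> L w" for w
    using moves(3)[of w] single[of w] that no by auto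
  have sU: "g w \<notin> L v" if "w \<in> U" "w \<in> S" "c \<in> L w" for w
    using sw_moves(3)[of w] single[of w] that no' by auto
  define R where "R = Nu \<union> Nv \<union> (D - {u, v})"
  have cover: "W - {u, v} \<subseteq> M \<union> R"
  proof
    fix w assume w: "w \<in> W - {u, v}"
    show "w \<in> M \<union> R"
    proof (cases "w \<in> D \<or> c \<notin> L w")
      case True
      then show ?thesis using w by (auto simp: M_def R_def)
    next
      case False
      then have "w \<in> S" using w WSD by auto
      then show ?thesis using False w sV[of w] sU[of w]
        by (auto simp: R_def Nu_def Nv_def W_iff)
    qed
  qed
  have fR: "finite R" using fN fD by (simp add: R_def)
  have "card R \<le> card Nu + card Nv + card (D - {u, v})"
    unfolding R_def using card_Un_le[of "Nu \<union> Nv" "D - {u, v}"] card_Un_le[of Nu Nv] by linarith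
  then have cR: "card R + 2 + 2 * card A \<le> card Nu + card Nv + 2 * card W"
    using cD cD2 by linarith
  have cM: "card M \<le> t" using missing by (simp add: M_def)
  have cWuv: "card W = card (W - {u, v}) + 2"
    using uW W gc(3) card_mono[of W "{u, v}"] by (simp add: card_Diff_subset)
  have sum: "card (W - {u, v}) + card (M \<inter> R) \<le> card M + card R"
    using card_mono[OF _ cover] card_Un_Int[OF fM fR] fM fR by simp
  \<comment> \<open>The terms in \<open>card A\<close> cancel, giving \<open>card W - 2 + card (M
    \<inter> R) \<le> t + 2 * t \<le> card W - 2\<close>; hence every estimate is sharp.\<close>
  have eq: "card W = 3 * t + 2" "card M = t" "card (M \<inter> R) = 0" "card Nv = card A - k"
    using sum cR cM cNu cNv cWuv kA cW size by linarith+
  then have "card U = 2" "0 < t" using tight cW by auto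
  have MR: "M \<inter> R = {}" using eq(3) fM by simp
  \<comment> \<open>Being outside \<open>R\<close>, \<open>w\<close> is a sole carrier whose color
    fits the opposite conflict vertex. By \<open>recolor_unused_via\<close> all of
    \<open>L w\<close> is then in use; \<open>c\<close> is in use too but not in \<open>L w\<close>,
    whence \<open>k < card A\<close>.\<close>
  obtain w where w: "w \<in> M" using eq(2) \<open>0 < t\<close> by fastforce
  then have wW: "w \<in> W" "c \<notin> L w" by (auto simp: M_def)
  have "w \<notin> R" using w MR by blast
  have "w \<noteq> u" "w \<noteq> v" using wW g[of u] g[of v] gc uW by auto
  then have "w \<notin> D" using \<open>w \<notin> R\<close> by (auto simp: R_def)
  then have wS: "w \<in> S" using wW WSD by blast
  have wu: "g w \<in> L u" if "w \<in> V" using that \<open>w \<notin> R\<close> wS by (auto simp: R_def Nu_def)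
  have wv: "g w \<in> L v" if "w \<in> U" using that \<open>w \<notin> R\<close> wS by (auto simp: R_def Nv_def)
  have Lw: "L w \<subseteq> A"
  proof
    fix z assume "z \<in> L w"
    show "z \<in> A"
    proof (cases "w \<in> V")
      case True
      then show ?thesis
        using moves(2)[of w z] single[OF wS] wu wW no \<open>z \<in> L w\<close> by (auto simp: A_def)
    next
      case False
      then have "w \<in> U" using wW by (auto simp: W_iff)
      then show ?thesis
        using sw_moves(2)[of w z] single[OF wS] wv wW no' \<open>z \<in> L w\<close> by (auto simp: A_def)
    qed
  qed
  have "c \<in> A" using uW gc by (auto simp: A_def)
  then have "k \<le> card (A - {c})"
    using L[of w] wW Lw fA card_mono[of "A - {c}" "L w"] by auto
  then have "k < card A" using \<open>c \<in> A\<close> fA by (metis Suc_le_eq card_Suc_Diff1 not_less_eq_eq order_le_less_trans lessI)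
  \<comment> \<open>Only the partner \<open>u'\<close> of \<open>u\<close> can lie in
    \<open>Nv\<close>, whose size \<open>card A - k\<close> is positive. So
    \<open>card A = k + 1\<close>, which pins down \<open>L v\<close> and \<open>L w\<close> as
    \<open>A\<close> minus one color.\<close>
  have "Nv \<subseteq> U - {u}" using uvD SD by (auto simp: Nv_def)
  then have "card Nv \<le> 1" using card_mono[of "U - {u}" Nv] fin uv(1) \<open>card U = 2\<close> by simp
  then have cA: "card A = k + 1" and "card Nv = 1" using eq(4) \<open>k < card A\<close> by auto
  then obtain u' where Nv: "Nv = {u'}" by (auto simp: card_1_singleton_iff)
  then have u': "u' \<in> U" "u' \<in> S" "g u' \<notin> L v" by (auto simp: Nv_def)
  then have u'W: "u' \<in> W" by (simp add: W_iff)
  have "u' \<in> R" using Nv by (simp add: R_def)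
  then have cu': "c \<in> L u'" using MR u'W by (auto simp: M_def)
  have "U - {u} = {u'}"
  proof (rule card_subset_eq[symmetric])
    show "{u'} \<subseteq> U - {u}" using \<open>Nv \<subseteq> U - {u}\<close> Nv by simp
  qed (use fin uv(1) \<open>card U = 2\<close> in auto)
  moreover have "w \<noteq> u'" using \<open>w \<notin> R\<close> \<open>u' \<in> R\<close> by metis
  ultimately have "w \<notin> U" using \<open>w \<noteq> u\<close> by (metis DiffI singletonD)
  then have wV: "w \<in> V" using wW(1) W_iff[of w] by simp
  have gA: "g u' \<in> A" "g w \<in> A" using u'W wW by (auto simp: A_def)
  have "g u' \<noteq> c" using single_neq(1)[of u', unfolded UV] single[OF u'(2)] by blast
  have Lw_eq: "L w = A - {c}"
  proof (rule card_subset_eq)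
    show "card (L w) = card (A - {c})" using L[of w] wW cA \<open>c \<in> A\<close> by simp
  qed (use fA Lw wW in auto)
  have Lv_eq: "L v = A - {g u'}"
  proof (rule card_subset_eq)
    show "card (L v) = card (A - {g u'})" using L[of v] uW cA gA by simp
  qed (use fA Lv u'(3) in auto)
  have "g w \<noteq> g u'" using single[OF u'(2) wW(1)] wV u'(1) disj by blast
  have "improves U V L g (g(u' := c, v := g w, w := g u'))"
  proof (rule rotate[unfolded UV])
    show "g w \<in> L v" using Lv_eq gA(2) \<open>g w \<noteq> g u'\<close> by simp
    show "g u' \<in> L w" using Lw_eq gA(1) \<open>g u' \<noteq> c\<close> by simp
    show "w' = u'" if "w' \<in> W" "g w' = g u'" for w' using single[OF u'(2) that] .
    show "w' = w" if "w' \<in> W" "g w' = g w" for w' using single[OF wS that] .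
  qed (fact u'(1) cu' wV)+
  with no show False by blast
qed

end

text \<open>Take an assignment within the bounds with the fewest conflicts. A conflicting color is
  used twice, so more than \<open>k\<close> lists contain it and at most \<open>t\<close> miss it;
  \<open>improvable\<close> then contradicts minimality.\<close>

lemma conflict_free_assignment:
  fixes L :: "'a \<Rightarrow> 'c set"
  assumes fin: "finite U" "finite V" and disj: "U \<inter> V = {}"
    and size: "2 \<le> card U" "2 \<le> card V"
    and k: "k = card U + card V - 1 - card V div 3"
    and L: "\<And>w. w \<in> U \<union> V \<Longrightarrow> finite (L w) \<and> card (L w) = k"
  obtains g where "\<And>w. w \<in> U \<union> V \<Longrightarrow> g w \<in> L w" "g ` U \<inter> g ` V = {}"
    and "\<And>x. of_bool (k \<le> card {w \<in> U \<union> V. x \<in> L w}) \<le> uses (U \<union> V) g x"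
    and "\<And>x. uses (U \<union> V) g x \<le> 1 + of_bool (k < card {w \<in> U \<union> V. x \<in> L w})"
proof -
  define W where "W = U \<union> V"
  define t where "t = card V div 3"
  define \<eta> where "\<eta> x = card {w \<in> W. x \<in> L w}" for x
  define ok where "ok g \<longleftrightarrow> (\<forall>w\<in>W. g w \<in> L w) \<and>
    (\<forall>x. of_bool (k \<le> \<eta> x) \<le> uses W g x \<and> uses W g x \<le> 1 + of_bool (k < \<eta> x))" for g
  have W: "finite W" using fin by (simp add: W_def)
  have cW: "card W = card U + card V" using fin disj by (simp add: W_def card_Un_disjoint)
  have Nk: "card U + card V = k + 1 + t" "3 * t \<le> card V" using k size by (auto simp: t_def)
  have "card W < 2 * k" using Nk size cW by linarith
  have \<eta>: "\<eta> x \<le> card W" for x unfolding \<eta>_def using W by (intro card_mono) auto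
  have "0 < k" using Nk size by linarith
  obtain g0 where "\<And>w. w \<in> W \<Longrightarrow> g0 w \<in> L w" "\<And>x. of_bool (k \<le> \<eta> x) \<le> uses W g0 x"
    "\<And>x. uses W g0 x \<le> 1 + of_bool (k < \<eta> x)"
  proof (rule exists_assignment_between[of W L k "\<lambda>x. of_bool (k \<le> \<eta> x)" "\<lambda>x. 1 + of_bool (k < \<eta> x)"])
    show "card {w \<in> W. x \<in> L w} \<le> k * (1 + of_bool (k < \<eta> x))" for x
      using \<eta>[of x] \<open>card W < 2 * k\<close> by (auto simp: \<eta>_def of_bool_def)
  qed (use W L \<open>0 < k\<close> in \<open>auto simp: W_def \<eta>_def of_bool_def\<close>)
  then have "ok g0" by (simp add: ok_def)
  then obtain g where okg: "ok g"
    and least: "\<And>g'. ok g' \<Longrightarrow> card (conflicts U V g) \<le> card (conflicts U V g')"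
    using ex_has_least_nat[of ok g0 "\<lambda>g. card (conflicts U V g)"] by blast
  have gL: "\<forall>w\<in>W. g w \<in> L w"
    and g_bounds: "of_bool (k \<le> \<eta> x) \<le> uses W g x" "uses W g x \<le> 1 + of_bool (k < \<eta> x)" for x
    using okg unfolding ok_def by blast+
  have "conflicts U V g = {}"
  proof (rule ccontr)
    assume "conflicts U V g \<noteq> {}"
    then obtain u v c where uv: "u \<in> U" "v \<in> V" "g u = c" "g v = c"
      unfolding conflicts_def by fastforce
    have "u \<noteq> v" using uv disj by blast
    have sub: "{u, v} \<subseteq> {w \<in> W. g w = c}" using uv by (auto simp: W_def)
    have "2 \<le> uses W g c" using card_mono[OF _ sub] W \<open>u \<noteq> v\<close> by (simp add: uses_def)
    then have "k < \<eta> c" "uses W g c = 2"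
      using g_bounds(2)[of c] by (auto simp: of_bool_def split: if_splits)
    have fiber: "{w \<in> W. g w = c} = {u, v}"
      by (rule card_subset_eq[OF _ sub, symmetric])
        (use W \<open>u \<noteq> v\<close> \<open>uses W g c = 2\<close> in \<open>auto simp: uses_def\<close>)
    interpret conflict U V L g u v c
    proof
      show "g w \<in> L w" if "w \<in> U \<union> V" for w using gL that by (simp add: W_def)
      show "{w \<in> U \<union> V. g w = c} = {u, v}" using fiber unfolding W_def .
    qed (fact fin disj uv)+
    have "card {w \<in> W. c \<notin> L w} + \<eta> c = card W"
    proof -
      have "W = {w \<in> W. c \<notin> L w} \<union> {w \<in> W. c \<in> L w}" by auto
      then have "card W = card ({w \<in> W. c \<notin> L w} \<union> {w \<in> W. c \<in> L w})" by simp
      also have "\<dots> = card {w \<in> W. c \<notin> L w} + \<eta> c"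
        unfolding \<eta>_def by (rule card_Un_disjoint) (use W in auto)
      finally show ?thesis by simp
    qed
    then have missing: "card {w \<in> W. c \<notin> L w} \<le> t" using \<open>k < \<eta> c\<close> Nk cW by linarith
    have "\<exists>g'. improves U V L g g'"
    proof (rule improvable[of k t])
      show "uses (U \<union> V) g x \<le> 2" for x
      proof -
        have "uses W g x \<le> 1 + of_bool (k < \<eta> x)" by (rule g_bounds)
        also have "\<dots> \<le> 2" by simp
        finally show ?thesis by (simp add: W_def)
      qed
      \<comment> \<open>Since \<open>2 \<le> card U\<close> and \<open>3 * t \<le> card V\<close>,
        equality of the sums makes both sharp; \<open>2 \<le> card V\<close> then excludes
        \<open>t = 0\<close>.\<close>
      show "card U = 2 \<and> 0 < t" if "card U + card V = 3 * t + 2"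
        using that Nk size by linarith
    qed (use L missing Nk size in \<open>auto simp: W_def\<close>)
    then obtain g' where g': "improves U V L g g'" by blast
    have "uses W g' x = uses W g x \<or> uses W g' x = 1" for x
      using g' by (simp add: improves_def W_def)
    then have "of_bool (k \<le> \<eta> x) \<le> uses W g' x \<and> uses W g' x \<le> 1 + of_bool (k < \<eta> x)" for x
      using g_bounds[of x] by (metis le_add1 of_bool_less_eq_one)
    then have "ok g'" using g' by (simp add: ok_def improves_def W_def)
    moreover have "card (conflicts U V g') < card (conflicts U V g)"
      using g' fin by (intro psubset_card_mono) (auto simp: improves_def conflicts_def)
    ultimately show False using least[of g'] by simp
  qed
  then have "g ` U \<inter> g ` V = {}" by (simp add: conflicts_def)
  with gL g_bounds show thesis
    unfolding W_def \<eta>_def by (intro that[of g]) simp_all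
qed

section \<open>From count bounds to proportional colorings\<close>

lemma count_floor_ceiling:
  assumes "0 < k" "0 < \<eta>" "\<eta> < 2 * k"
    and "of_bool (k \<le> \<eta>) \<le> a" "a \<le> 1 + of_bool (k < \<eta>)"
  shows "int a = \<lfloor>real \<eta> / real k\<rfloor> \<or> int a = \<lceil>real \<eta> / real k\<rceil>"
proof -
  \<comment> \<open>The quotient lies strictly between 0 and 2, so floor and ceiling are 0 and 1,
    both 1, or 1 and 2.\<close>
  consider "\<eta> < k" | "\<eta> = k" | "k < \<eta>" by linarith
  then show ?thesis
  proof cases
    case 1
    then have "\<lfloor>real \<eta> / real k\<rfloor> = 0" "\<lceil>real \<eta> / real k\<rceil> = 1"
      using assms(1,2) by (auto simp: floor_eq_iff ceiling_eq_iff)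
    moreover have "a = 0 \<or> a = 1" using 1 assms(5) by auto
    ultimately show ?thesis by auto
  next
    case 2
    then show ?thesis using assms by auto
  next
    case 3
    then have "\<lfloor>real \<eta> / real k\<rfloor> = 1" "\<lceil>real \<eta> / real k\<rceil> = 2"
      using assms(1,3) by (auto simp: floor_eq_iff ceiling_eq_iff field_simps)
    moreover have "a = 1 \<or> a = 2" using 3 assms(4,5) by auto
    ultimately show ?thesis by auto
  qed
qed

lemma proportionally_choosable_bipartite:
  fixes G :: "('a, 'b) pre_digraph"
  assumes "K\<^bsub>n,m\<^esub> G" "2 \<le> n" "2 \<le> m"
  shows "proportionally_choosable G (n + m - 1 - m div 3)"
  unfolding proportionally_choosable_def
proof (intro allI impI)
  fix L :: "'a \<Rightarrow> nat set"
  define k where "k = n + m - 1 - m div 3"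
  assume "k_assignment G (n + m - 1 - m div 3) L"
  then have kL: "k_assignment G k L" by (simp add: k_def)
  obtain U V where UV: "verts G = U \<union> V" "U \<inter> V = {}" "card U = n" "card V = m"
      "arcs_ends G = U \<times> V \<union> V \<times> U"
    using assms(1) by (auto simp: complete_bipartite_digraph_def)
  have fin: "finite U" "finite V" using UV assms by (auto intro!: card_ge_0_finite)
  have L: "finite (L w) \<and> card (L w) = k" if "w \<in> U \<union> V" for w
    using kL that UV(1) by (auto simp: k_assignment_def)
  obtain g where g: "\<And>w. w \<in> U \<union> V \<Longrightarrow> g w \<in> L w" "g ` U \<inter> g ` V = {}"
    "\<And>x. of_bool (k \<le> card {w \<in> U \<union> V. x \<in> L w}) \<le> uses (U \<union> V) g x"
    "\<And>x. uses (U \<union> V) g x \<le> 1 + of_bool (k < card {w \<in> U \<union> V. x \<in> L w})"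
  proof (rule conflict_free_assignment[OF fin UV(2), of k L])
    show "k = card U + card V - 1 - card V div 3" by (simp add: UV(3,4) k_def)
    show "finite (L w) \<and> card (L w) = k" if "w \<in> U \<union> V" for w using L[OF that] .
    show "2 \<le> card U" "2 \<le> card V" using UV(3,4) assms(2,3) by simp_all
  qed (rule that)
  have "proper_list_coloring G L g"
    using g(1,2) UV by (auto simp: proper_list_coloring_def)
  moreover have "int (card {v \<in> verts G. g v = c}) = \<lfloor>real (multiplicity_in G L c) / real k\<rfloor> \<or>
      int (card {v \<in> verts G. g v = c}) = \<lceil>real (multiplicity_in G L c) / real k\<rceil>"
    if "c \<in> palette G L" for c
  proof (rule count_floor_ceiling)
    show "0 < k" using assms by (simp add: k_def)
    have "{v \<in> verts G. c \<in> L v} \<noteq> {}" using that by (auto simp: palette_def)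
    then show "0 < multiplicity_in G L c"
      using fin UV(1) by (simp add: multiplicity_in_def card_gt_0_iff)
    have "multiplicity_in G L c \<le> card (U \<union> V)"
      unfolding multiplicity_in_def using fin UV(1) by (intro card_mono) auto
    also have "\<dots> = n + m" using fin UV by (simp add: card_Un_disjoint)
    also have "\<dots> < 2 * k" using assms(2,3) unfolding k_def by linarith
    finally show "multiplicity_in G L c < 2 * k" .
    show "of_bool (k \<le> multiplicity_in G L c) \<le> card {v \<in> verts G. g v = c}"
      using g(3)[of c] by (simp add: uses_def multiplicity_in_def UV(1))
    show "card {v \<in> verts G. g v = c} \<le> 1 + of_bool (k < multiplicity_in G L c)"
      using g(4)[of c] unfolding uses_def multiplicity_in_def UV(1) .
  qed
  ultimately show "\<exists>f. proportional_coloring G (n + m - 1 - m div 3) L f"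
    unfolding proportional_coloring_def k_def by blast
qed

subsection \<open>Lower bounds\<close>

text \<open>Floor and ceiling agree when \<open>k\<close> divides the multiplicity; positivity puts
  \<open>c\<close> into the palette.\<close>

lemma proportional_coloring_card:
  assumes "proportional_coloring G k L f" "multiplicity_in G L c = j * k" "0 < j * k"
  shows "card {v \<in> verts G. f v = c} = j"
proof -
  have "{v \<in> verts G. c \<in> L v} \<noteq> {}"
    using assms(2,3) unfolding multiplicity_in_def by (metis card.empty less_irrefl)
  then have "c \<in> palette G L" by (auto simp: palette_def)
  then have "int (card {v \<in> verts G. f v = c}) = \<lfloor>real (multiplicity_in G L c) / real k\<rfloor> \<or>
      int (card {v \<in> verts G. f v = c}) = \<lceil>real (multiplicity_in G L c) / real k\<rceil>"
    using assms(1) unfolding proportional_coloring_def by blast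
  moreover have "real (multiplicity_in G L c) / real k = real j" using assms(2,3) by simp
  ultimately show ?thesis by simp
qed

lemma not_proportionally_choosable_le:
  fixes G :: "('a, 'b) pre_digraph"
  assumes G: "K\<^bsub>n,m\<^esub> G" and k: "1 \<le> k" "k \<le> n" "k \<le> m"
  shows "\<not> proportionally_choosable G k"
proof
  assume pc: "proportionally_choosable G k"
  obtain U V where UV: "verts G = U \<union> V" "U \<inter> V = {}" "card U = n" "card V = m"
      "arcs_ends G = U \<times> V \<union> V \<times> U"
    using G by (auto simp: complete_bipartite_digraph_def)
  obtain A where A: "A \<subseteq> U" "card A = k" using obtain_subset_with_card_n[of k U] k UV(3) by metis
  obtain B where B: "B \<subseteq> V" "card B = k" using obtain_subset_with_card_n[of k V] k UV(4) by metis
  have fin: "finite U" "finite V" using UV k by (auto intro!: card_ge_0_finite)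
  have fAB: "finite A" "finite B" using A B fin finite_subset by blast+
  have AB: "A \<inter> B = {}" using A B UV by blast
  \<comment> \<open>The lists on \<open>A\<close> and on \<open>B\<close> consist of 0 and
    \<open>k - 1\<close> private colors, hence the end \<open>2 * k - 1\<close>. Fresh colors
    elsewhere keep the multiplicity of private colors at exactly \<open>k\<close>.\<close>
  define L where "L v = (if v \<in> A then {0..<k} else if v \<in> B then insert 0 {k..<2*k-1} else {2*k..<3*k})" for v
  have "k_assignment G k L"
    using k by (auto simp: k_assignment_def L_def)
  then obtain f where f: "proportional_coloring G k L f"
    using pc by (auto simp: proportionally_choosable_def)
  have fL: "f v \<in> L v" if "v \<in> U \<union> V" for v
    using f that UV(1) by (auto simp: proportional_coloring_def proper_list_coloring_def)
  have proper: "f a \<noteq> f b" if "a \<in> U" "b \<in> V" for a b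
    using f that UV(5) by (auto simp: proportional_coloring_def proper_list_coloring_def)
  have mult: "multiplicity_in G L x = card X" if "X \<subseteq> U \<union> V" "\<And>v. x \<in> L v \<longleftrightarrow> v \<in> X" for x X
  proof -
    have "{v \<in> verts G. x \<in> L v} = X" using that UV(1) by auto
    then show ?thesis by (simp add: multiplicity_in_def)
  qed
  have "multiplicity_in G L 0 = card (A \<union> B)"
    by (rule mult) (use A B k in \<open>auto simp: L_def\<close>)
  then have "multiplicity_in G L 0 = 2 * k"
    using fAB AB A B by (simp add: card_Un_disjoint)
  \<comment> \<open>Colors of multiplicity \<open>k\<close> are used exactly once, so
    \<open>f\<close> would inject the \<open>k\<close> vertices of \<open>X\<close> into fewer
    colors.\<close>
  have pigeonhole: False
    if X: "finite X" "card X = k" "X \<subseteq> U \<union> V" and C: "card C < k" "finite C" "f ` X \<subseteq> C"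
      and m: "\<And>x. x \<in> C \<Longrightarrow> multiplicity_in G L x = k" for X C
  proof -
    have "inj_on f X"
    proof (rule inj_onI)
      fix a b assume ab: "a \<in> X" "b \<in> X" "f a = f b"
      have "card {v \<in> verts G. f v = f a} = 1"
        using proportional_coloring_card[OF f, of "f a" 1] m[of "f a"] C(3) ab(1) k by auto
      then obtain y where "{v \<in> verts G. f v = f a} = {y}" by (auto simp: card_1_singleton_iff)
      moreover have "a \<in> {v \<in> verts G. f v = f a}" "b \<in> {v \<in> verts G. f v = f a}"
        using ab X UV(1) by auto
      ultimately show "a = b" by (metis singletonD)
    qed
    then have "card X \<le> card C" using C card_inj_on_le by metis
    then show False using X C by simp
  qed
  have "0 \<notin> f ` A \<or> 0 \<notin> f ` B" 
  proof (rule ccontr)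
    assume "\<not> ?thesis"
    then obtain a b where "a \<in> A" "f a = 0" "b \<in> B" "f b = 0" by fastforce
    then show False using proper[of a b] A(1) B(1) by auto
  qed
  then show False
  proof
    assume "0 \<notin> f ` A"
    show False
    proof (rule pigeonhole[of A "{1..<k}"])
      show "f ` A \<subseteq> {1..<k}"
      proof
        fix x assume "x \<in> f ` A"
        then obtain a where a: "a \<in> A" "x = f a" by blast
        then have "x \<in> {0..<k}" using fL[of a] A(1) by (auto simp: L_def)
        moreover have "x \<noteq> 0" using a \<open>0 \<notin> f ` A\<close> by auto
        ultimately show "x \<in> {1..<k}" by auto
      qed
      show "multiplicity_in G L x = k" if "x \<in> {1..<k}" for x
      proof -
        have "x \<in> L v \<longleftrightarrow> v \<in> A" for v using that by (auto simp: L_def)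
        then show ?thesis using mult[of A x] A by blast
      qed
    qed (use fAB A k in auto)
  next
    assume "0 \<notin> f ` B"
    show False
    proof (rule pigeonhole[of B "{k..<2*k-1}"])
      show "f ` B \<subseteq> {k..<2*k-1}"
      proof
        fix x assume x: "x \<in> f ` B"
        then have "x \<noteq> 0" using \<open>0 \<notin> f ` B\<close> by auto
        moreover have "x \<in> insert 0 {k..<2*k-1}"
        proof -
          obtain b where b: "b \<in> B" "x = f b" using x by blast
          then have "b \<notin> A" "b \<in> U \<union> V" using AB B by auto
          then show ?thesis using b fL[of b] by (simp add: L_def)
        qed
        ultimately show "x \<in> {k..<2*k-1}" by auto
      qed
      show "multiplicity_in G L x = k" if "x \<in> {k..<2*k-1}" for x
      proof -
        have "x \<in> L v \<longleftrightarrow> v \<in> B" for v using that k AB by (auto simp: L_def)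
        then show ?thesis using mult[of B x] B by blast
      qed
    qed (use fAB B k in auto)
  qed
qed

lemma not_proportionally_choosable_odd:
  fixes G :: "('a, 'b) pre_digraph"
  assumes G: "K\<^bsub>n,m\<^esub> G" and ab: "odd a" "odd b" "a \<le> n" "b \<le> m" "a + b = 2 * k"
  shows "\<not> proportionally_choosable G k"
proof
  assume pc: "proportionally_choosable G k"
  obtain U V where UV: "verts G = U \<union> V" "U \<inter> V = {}" "card U = n" "card V = m"
      "arcs_ends G = U \<times> V \<union> V \<times> U"
    using G by (auto simp: complete_bipartite_digraph_def)
  obtain A where A: "A \<subseteq> U" "card A = a" using obtain_subset_with_card_n[of a U] ab UV(3) by metis
  obtain B where B: "B \<subseteq> V" "card B = b" using obtain_subset_with_card_n[of b V] ab UV(4) by metis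
  have pos: "0 < a" "0 < b" using ab by (auto intro: odd_pos)
  then have "0 < k" using ab by linarith
  have fAB: "finite A" "finite B" using A B pos by (auto intro!: card_ge_0_finite)
  have AB: "A \<inter> B = {}" using A B UV by blast
  define L where "L v = (if v \<in> A \<union> B then {0..<k} else {k..<2*k})" for v
  have "k_assignment G k L"
    by (auto simp: k_assignment_def L_def)
  then obtain f where f: "proportional_coloring G k L f"
    using pc by (auto simp: proportionally_choosable_def)
  have fL: "f v \<in> L v" if "v \<in> U \<union> V" for v
    using f that UV(1) by (auto simp: proportional_coloring_def proper_list_coloring_def)
  have proper: "f a \<noteq> f b" if "a \<in> U" "b \<in> V" for a b
    using f that UV(5) by (auto simp: proportional_coloring_def proper_list_coloring_def)
  \<comment> \<open>The two uses of \<open>x\<close> lie in \<open>A \<union> B\<close> by the lists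
    and on one side by properness, so \<open>A\<close> gets both or neither.\<close>
  have "even (uses A f x)" if x: "x < k" for x
  proof -
    have "{v \<in> verts G. x \<in> L v} = A \<union> B" using A B UV(1) x by (auto simp: L_def)
    then have "multiplicity_in G L x = 2 * k"
      using ab A B AB fAB by (simp add: multiplicity_in_def card_Un_disjoint)
    then have two: "card {v \<in> verts G. f v = x} = 2"
      using proportional_coloring_card[OF f, of x 2] \<open>0 < k\<close> by simp
    show ?thesis
    proof (cases "\<exists>a\<in>A. f a = x")
      case True
      then obtain a where a: "a \<in> A" "f a = x" by blast
      have "{v \<in> verts G. f v = x} = {v \<in> A. f v = x}"
      proof (intro equalityI subsetI)
        fix v assume v: "v \<in> {v \<in> verts G. f v = x}"
        then have "v \<in> A \<union> B" using fL[of v] x UV(1) by (auto simp: L_def split: if_splits)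
        moreover have "v \<notin> B" using proper[of a v] a v A(1) B(1) by auto
        ultimately show "v \<in> {v \<in> A. f v = x}" using v by auto
      qed (use A UV(1) in auto)
      then show ?thesis using two by (simp add: uses_def)
    next
      case False
      then have "{v \<in> A. f v = x} = {}" by auto
      then show ?thesis unfolding uses_def by (metis card.empty even_zero)
    qed
  qed
  \<comment> \<open>Every vertex of \<open>A\<close> is counted once in this sum, so
    \<open>a\<close> would be even.\<close>
  then have "even (\<Sum>x\<in>{..<k}. uses A f x)" by (intro dvd_sum) auto
  also have "(\<Sum>x\<in>{..<k}. uses A f x) = card {v \<in> A. f v \<in> {..<k}}"
    using fAB by (simp add: sum_uses)
  also have "{v \<in> A. f v \<in> {..<k}} = A"
  proof -
    have "f v < k" if "v \<in> A" for v using fL[of v] that A(1) by (auto simp: L_def)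
    then show ?thesis by auto
  qed
  finally show False using A ab by simp
qed

lemma not_proportionally_choosable_lt:
  fixes G :: "('a, 'b) pre_digraph"
  assumes "K\<^bsub>n,m\<^esub> G" "1 \<le> n" "1 \<le> m" "1 \<le> k" "k < (n + 1) div 2 + (m + 1) div 2"
  shows "\<not> proportionally_choosable G k"
proof -
  \<comment> \<open>The odd sizes \<open>2 * i - 1\<close> and \<open>2 * j - 1\<close> must add up
    to \<open>2 * k\<close>, so \<open>i + j = k + 1\<close>. Taking \<open>i\<close> as large as
    \<open>n\<close> and \<open>1 \<le> j\<close> permit keeps \<open>2 * j - 1\<close> within
    \<open>m\<close>.\<close>
  define i where "i = min ((n + 1) div 2) k"
  define j where "j = k + 1 - i"
  have ij: "1 \<le> i" "1 \<le> j" "2 * i \<le> n + 1" "2 * j \<le> m + 1" "i + j = k + 1"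
    using assms(2-5) by (auto simp: i_def j_def min_def)
  show ?thesis
    by (rule not_proportionally_choosable_odd[OF assms(1), of "2 * i - 1" "2 * j - 1"])
      (use ij in auto)
qed

section \<open>The bounds combined\<close>

theorem theorem6:
  fixes n m :: nat and G :: "('a, 'b) pre_digraph"
  assumes "2 \<le> n" and "n \<le> m"
    and "K\<^bsub>n,m\<^esub> G"
  shows "max (int n + 1) (\<lceil>real n / 2\<rceil> + \<lceil>real m / 2\<rceil>) \<le> int (\<chi>\<^sub>p\<^sub>c G)
       \<and> int (\<chi>\<^sub>p\<^sub>c G) \<le> int n + int m - 1 - \<lfloor>real m / 3\<rfloor>"
proof -
  define K where "K = n + m - 1 - m div 3"
  \<comment> \<open>The witness \<open>K\<close> ensures that the least value is attained, so the
    choice number itself qualifies and the lower bounds can be applied to it.\<close>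
  have K: "1 \<le> K \<and> proportionally_choosable G K"
    using proportionally_choosable_bipartite[OF assms(3)] assms(1,2) by (simp add: K_def)
  then have chi: "1 \<le> \<chi>\<^sub>p\<^sub>c G" "proportionally_choosable G (\<chi>\<^sub>p\<^sub>c G)"
    using LeastI[of "\<lambda>k. 1 \<le> k \<and> proportionally_choosable G k" K]
    by (simp_all add: proportional_choice_number_def)
  have "\<chi>\<^sub>p\<^sub>c G \<le> K"
    unfolding proportional_choice_number_def using K by (rule Least_le)
  moreover have "\<lfloor>real m / 3\<rfloor> = int (m div 3)"
    by (metis floor_divide_of_nat_eq of_nat_numeral)
  then have "int K = int n + int m - 1 - \<lfloor>real m / 3\<rfloor>"
    using assms(1,2) by (simp add: K_def)
  moreover have "n + 1 \<le> \<chi>\<^sub>p\<^sub>c G"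
    using not_proportionally_choosable_le[OF assms(3) chi(1)] chi(2) assms(2) by linarith
  moreover have "(n + 1) div 2 + (m + 1) div 2 \<le> \<chi>\<^sub>p\<^sub>c G"
    using not_proportionally_choosable_lt[OF assms(3) _ _ chi(1)] chi(2) assms(1,2) by linarith
  moreover have "\<lceil>real j / 2\<rceil> = int ((j + 1) div 2)" for j
    by (simp add: ceiling_eq_iff) linarith
  ultimately show ?thesis by simp
qed

end
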